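(* For every $s\ge1$, the logic $\mathsf L(\mathfrak F_2+\mathfrak F_s)$ has nullary unification.
   Context: A frame is a finite poset with a least element; $\mathsf L(\mathfrak F)$ is the set of intuitionistic formulas valid in all Kripke models over $\mathfrak F$. For $n\ge2$ the $n$-fork $\mathfrak F_n$ is a root with $n$ pairwise incomparable maximal elements above it; $\mathfrak F_1$ is the two-element chain. For disjoint frames $\mathfrak F=(W,\le_W,w_0)$, $\mathfrak G=(U,\le_U,u_0)$, the join $\mathfrak F+\mathfrak G$ is $W\cup U$ rooted at $w_0$ with $x\le y$ iff $x\le_W y$ or $x\le_U y$ or ($x\in W$ and $y\in U$). Unification in a logic $\mathsf L$ is nullary if some $\mathsf L$-unifiable formula has no minimal (w.r.t. inclusion) complete set of unifiers, where a set $\Sigma$ of unifiers of $A$ is complete if every unifier $\mu$ of $A$ satisfies $\alpha\circ\varepsilon=_{\mathsf L}\mu$ for some $\varepsilon\in\Sigma$ and some substitution $\alpha$. *)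

theory Defs
  imports Main
begin

datatype fm =
    Var nat
  | Bot
  | And fm fm
  | Or fm fm
  | Imp fm fm

definition Iff :: "fm \<Rightarrow> fm \<Rightarrow> fm" where
  "Iff A B = And (Imp A B) (Imp B A)"

fun vars :: "fm \<Rightarrow> nat set" where
  "vars (Var p) = {p}"
| "vars Bot = {}"
| "vars (And A B) = vars A \<union> vars B"
| "vars (Or A B) = vars A \<union> vars B"
| "vars (Imp A B) = vars A \<union> vars B"

type_synonym sbst = "nat \<Rightarrow> fm"

fun subst :: "sbst \<Rightarrow> fm \<Rightarrow> fm" where
  "subst \<sigma> (Var p) = \<sigma> p"
| "subst \<sigma> Bot = Bot"
| "subst \<sigma> (And A B) = And (subst \<sigma> A) (subst \<sigma> B)"
| "subst \<sigma> (Or A B) = Or (subst \<sigma> A) (subst \<sigma> B)"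
| "subst \<sigma> (Imp A B) = Imp (subst \<sigma> A) (subst \<sigma> B)"

definition comp_sbst :: "sbst \<Rightarrow> sbst \<Rightarrow> sbst" where
  "comp_sbst \<alpha> \<epsilon> = (\<lambda>p. subst \<alpha> (\<epsilon> p))"

record 'w frame =
  worlds :: "'w set"
  ord :: "('w \<times> 'w) set"

definition is_frame :: "'w frame \<Rightarrow> bool" where
  "is_frame F \<longleftrightarrow> finite (worlds F) \<and> partial_order_on (worlds F) (ord F)
     \<and> (\<exists>w0\<in>worlds F. \<forall>w\<in>worlds F. (w0, w) \<in> ord F)"

definition valuation :: "'w frame \<Rightarrow> (nat \<Rightarrow> 'w set) \<Rightarrow> bool" where
  "valuation F V \<longleftrightarrow> (\<forall>p. V p \<subseteq> worlds F \<and>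
     (\<forall>w u. w \<in> V p \<and> (w, u) \<in> ord F \<longrightarrow> u \<in> V p))"

fun forces :: "'w frame \<Rightarrow> (nat \<Rightarrow> 'w set) \<Rightarrow> 'w \<Rightarrow> fm \<Rightarrow> bool" where
  "forces F V w (Var p) \<longleftrightarrow> w \<in> V p"
| "forces F V w Bot \<longleftrightarrow> False"
| "forces F V w (And A B) \<longleftrightarrow> forces F V w A \<and> forces F V w B"
| "forces F V w (Or A B) \<longleftrightarrow> forces F V w A \<or> forces F V w B"
| "forces F V w (Imp A B) \<longleftrightarrow>
     (\<forall>u\<in>worlds F. (w, u) \<in> ord F \<longrightarrow> forces F V u A \<longrightarrow> forces F V u B)"

definition logic_of :: "'w frame \<Rightarrow> fm set" where
  "logic_of F = {A. \<forall>V. valuation F V \<longrightarrow> (\<forall>w\<in>worlds F. forces F V w A)}"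

(* The root is 0 and the maximal elements are 1, ..., n; for n = 1 this is the
   two-element chain. *)
definition fork :: "nat \<Rightarrow> nat frame" where
  "fork n = \<lparr>worlds = {0..n},
             ord = {(x, y). x \<in> {0..n} \<and> y \<in> {0..n} \<and> (x = 0 \<or> x = y)}\<rparr>"

(* Disjointness of the two frames is ensured by the sum type. *)
definition join :: "'a frame \<Rightarrow> 'b frame \<Rightarrow> ('a + 'b) frame" where
  "join F G = \<lparr>worlds = worlds F <+> worlds G,
               ord = {(Inl x, Inl y) | x y. (x, y) \<in> ord F}
                   \<union> {(Inr x, Inr y) | x y. (x, y) \<in> ord G}
                   \<union> {(Inl x, Inr y) | x y. x \<in> worlds F \<and> y \<in> worlds G}\<rparr>"

lemma is_frame_fork: "is_frame (fork n)"
  unfolding is_frame_def fork_def partial_order_on_def preorder_on_def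
  by (simp, intro conjI refl_onI transI antisymI) auto

lemma is_frame_join:
  assumes "is_frame F" "is_frame G"
  shows "is_frame (join F G)"
proof -
  obtain w0 where w0: "w0 \<in> worlds F" "\<forall>w\<in>worlds F. (w0, w) \<in> ord F"
    using assms(1) unfolding is_frame_def by blast
  have sub: "ord F \<subseteq> worlds F \<times> worlds F" "ord G \<subseteq> worlds G \<times> worlds G"
    using assms unfolding is_frame_def partial_order_on_def preorder_on_def refl_on_def by blast+
  have "partial_order_on (worlds (join F G)) (ord (join F G))"
    unfolding partial_order_on_def preorder_on_def
  proof (intro conjI)
    show "refl_on (worlds (join F G)) (ord (join F G))"
    proof (rule refl_onI)
      fix x
      have "refl_on (worlds F) (ord F)" "refl_on (worlds G) (ord G)"
        using assms unfolding is_frame_def partial_order_on_def preorder_on_def by blast+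
      then show "(x, x) \<in> ord (join F G)" if "x \<in> worlds (join F G)"
        using that by (cases x) (auto simp: join_def dest: refl_onD)
    qed
    show "trans (ord (join F G))"
    proof (rule transI)
      fix x y z
      have "trans (ord F)" "trans (ord G)"
        using assms unfolding is_frame_def partial_order_on_def preorder_on_def by blast+
      then show "(x, z) \<in> ord (join F G)"
        if "(x, y) \<in> ord (join F G)" "(y, z) \<in> ord (join F G)"
        using that sub by (cases x; cases y; cases z) (auto simp: join_def dest: transD)
    qed
    show "antisym (ord (join F G))"
    proof (rule antisymI)
      fix x y
      have "antisym (ord F)" "antisym (ord G)"
        using assms unfolding is_frame_def partial_order_on_def by blast+
      then show "x = y"
        if "(x, y) \<in> ord (join F G)" "(y, x) \<in> ord (join F G)"
        using that by (cases x; cases y) (auto simp: join_def dest: antisymD)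
    qed
    show "ord (join F G) \<subseteq> worlds (join F G) \<times> worlds (join F G)"
      using sub by (auto simp: join_def)
  qed
  moreover have "finite (worlds (join F G))"
    using assms by (simp add: is_frame_def join_def)
  moreover have "Inl w0 \<in> worlds (join F G)"
      "\<forall>w\<in>worlds (join F G). (Inl w0, w) \<in> ord (join F G)"
    using w0 by (auto simp: join_def)
  ultimately show ?thesis
    unfolding is_frame_def by blast
qed

definition unifier :: "fm set \<Rightarrow> fm \<Rightarrow> sbst \<Rightarrow> bool" where
  "unifier L A \<sigma> \<longleftrightarrow> subst \<sigma> A \<in> L"

definition unifiable :: "fm set \<Rightarrow> fm \<Rightarrow> bool" where
  "unifiable L A \<longleftrightarrow> (\<exists>\<sigma>. unifier L A \<sigma>)"

definition sbst_eq :: "fm set \<Rightarrow> nat set \<Rightarrow> sbst \<Rightarrow> sbst \<Rightarrow> bool" where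
  "sbst_eq L X \<sigma> \<tau> \<longleftrightarrow> (\<forall>p\<in>X. Iff (\<sigma> p) (\<tau> p) \<in> L)"

(* Unifiers of A are finite mappings, defined on the variables of A. They are
   represented by total functions, so they are compared on vars A only; the
   values outside vars A are irrelevant. *)
definition complete_unifiers :: "fm set \<Rightarrow> fm \<Rightarrow> sbst set \<Rightarrow> bool" where
  "complete_unifiers L A \<Sigma> \<longleftrightarrow> (\<forall>\<epsilon>\<in>\<Sigma>. unifier L A \<epsilon>) \<and>
     (\<forall>\<mu>. unifier L A \<mu> \<longrightarrow> (\<exists>\<epsilon>\<in>\<Sigma>. \<exists>\<alpha>. sbst_eq L (vars A) (comp_sbst \<alpha> \<epsilon>) \<mu>))"

definition minimal_complete_unifiers :: "fm set \<Rightarrow> fm \<Rightarrow> sbst set \<Rightarrow> bool" where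
  "minimal_complete_unifiers L A \<Sigma> \<longleftrightarrow> complete_unifiers L A \<Sigma> \<and>
     (\<forall>\<Sigma>'. \<Sigma>' \<subset> \<Sigma> \<longrightarrow> \<not> complete_unifiers L A \<Sigma>')"

definition nullary_unification :: "fm set \<Rightarrow> bool" where
  "nullary_unification L \<longleftrightarrow>
     (\<exists>A. unifiable L A \<and> \<not> (\<exists>\<Sigma>. minimal_complete_unifiers L A \<Sigma>))"

end

theory Submission imports Defs begin

text \<open>
  The formula \<open>A = (v \<or> w) \<and> \<not>\<not>v \<and> \<not>\<not>w\<close> has no maximally general unifier.
  Any two unifiers \<open>\<epsilon>\<close>, \<open>\<sigma>\<close> of \<open>A\<close> are instances of the unifier
  \<open>(\<not>t \<rightarrow> \<epsilon>) \<and> (\<not>\<not>t \<rightarrow> \<sigma>)\<close> with \<open>t\<close> fresh: a world whose final successors disagree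
  on \<open>t\<close> sees, besides such worlds, only final worlds, where \<open>v\<close> and \<open>w\<close> are true.
  Hence it suffices to find, for every unifier \<open>\<epsilon>\<close>, a unifier that is not an instance of it.

  With \<open>E\<close> the conjunction of the variables \<open>z\<^sub>0, \<dots>, z\<^bsub>m-1\<^esub>\<close> and \<open>Lin\<close> the conjunction of all
  \<open>(z\<^sub>i \<rightarrow> z\<^sub>j) \<or> (z\<^sub>j \<rightarrow> z\<^sub>i)\<close>, a unifier is given by \<open>v := \<not>\<not>E \<rightarrow> Lin\<close> and
  \<open>w := \<not>\<not>E \<and> Lin \<rightarrow> z\<^sub>0 \<or> \<dots> \<or> z\<^bsub>m-1\<^esub>\<close>. Let \<open>C\<^sub>i\<close> be the two-element chain in which all variables
  are true at the top and only \<open>z\<^sub>i\<close> is false at the bottom. Here \<open>w\<close> fails at a world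
  forcing no variable placed below \<open>C\<^sub>i\<close>, and \<open>v\<close> fails at a world forcing no variable placed
  below \<open>C\<^sub>i\<close> and \<open>C\<^sub>j\<close> (glued at the top) for \<open>i \<noteq> j\<close>. If this unifier were an instance of
  \<open>\<epsilon>\<close> via \<open>\<alpha>\<close> and \<open>m\<close> is large, then \<open>\<alpha>\<close> identifies \<open>C\<^sub>i\<close> and \<open>C\<^sub>j\<close> on the variables of \<open>\<epsilon>\<close> for
  some \<open>i \<noteq> j\<close>. The two worlds can then be placed below one and the same chain, and under \<open>\<epsilon>\<close>
  neither \<open>v\<close> nor \<open>w\<close> is true at a common root of them.
\<close>

section \<open>Kripke semantics of substitutions\<close>

lemma is_frameD:
  assumes "is_frame F"
  shows "w \<in> worlds F \<Longrightarrow> (w, w) \<in> ord F"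
    and "(u, v) \<in> ord F \<Longrightarrow> (v, w) \<in> ord F \<Longrightarrow> (u, w) \<in> ord F"
    and "(u, v) \<in> ord F \<Longrightarrow> u \<in> worlds F \<and> v \<in> worlds F"
  using assms unfolding is_frame_def partial_order_on_def preorder_on_def refl_on_def trans_def
  by blast+

lemma forces_mono:
  assumes "is_frame F" "valuation F V"
  shows "(w, u) \<in> ord F \<Longrightarrow> forces F V w A \<Longrightarrow> forces F V u A"
proof (induction A)
  case (Var p)
  then show ?case using assms(2) unfolding valuation_def by auto
next
  case (Imp A B)
  then show ?case using is_frameD(2)[OF assms(1)] by auto
qed auto

text \<open>The action of \<sigma> on models: substituting in the formula amounts to changing the
  valuation.\<close>

definition pull :: "'w frame \<Rightarrow> sbst \<Rightarrow> (nat \<Rightarrow> 'w set) \<Rightarrow> nat \<Rightarrow> 'w set" where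
  "pull F \<sigma> V p = {w \<in> worlds F. forces F V w (\<sigma> p)}"

lemma valuation_pull:
  assumes "is_frame F" "valuation F V"
  shows "valuation F (pull F \<sigma> V)"
  using forces_mono[OF assms] is_frameD(3)[OF assms(1)]
  unfolding valuation_def pull_def by blast

lemma forces_subst:
  "w \<in> worlds F \<Longrightarrow> forces F V w (subst \<sigma> A) \<longleftrightarrow> forces F (pull F \<sigma> V) w A"
  by (induction A arbitrary: w) (auto simp: pull_def)

lemma Iff_in_logic_of:
  assumes "is_frame F"
  shows "Iff A B \<in> logic_of F \<longleftrightarrow>
    (\<forall>V. valuation F V \<longrightarrow> (\<forall>w\<in>worlds F. forces F V w A \<longleftrightarrow> forces F V w B))"
  using is_frameD(1)[OF assms] unfolding logic_of_def Iff_def by auto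

lemma subst_comp_sbst: "subst (comp_sbst \<alpha> \<epsilon>) A = subst \<alpha> (subst \<epsilon> A)"
  by (induction A) (auto simp: comp_sbst_def)

lemma subst_fresh: "t \<notin> vars A \<Longrightarrow> subst (Var(t := B)) A = A"
  by (induction A) auto

lemma finite_vars: "finite (vars A)"
  by (induction A) auto

text \<open>A bisimulation need only respect the variables in \<open>K\<close>; this later allows
  worlds that differ elsewhere to be identified.\<close>

lemma forces_bisimilar:
  assumes atoms: "\<And>w w' p. Z w w' \<Longrightarrow> p \<in> K \<Longrightarrow> w \<in> V p \<longleftrightarrow> w' \<in> V' p"
    and zig: "\<And>w w' u. Z w w' \<Longrightarrow> u \<in> worlds F \<Longrightarrow> (w, u) \<in> ord F \<Longrightarrow>
      \<exists>u'\<in>worlds G. (w', u') \<in> ord G \<and> Z u u'"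
    and zag: "\<And>w w' u'. Z w w' \<Longrightarrow> u' \<in> worlds G \<Longrightarrow> (w', u') \<in> ord G \<Longrightarrow>
      \<exists>u\<in>worlds F. (w, u) \<in> ord F \<and> Z u u'"
  shows "vars B \<subseteq> K \<Longrightarrow> Z w w' \<Longrightarrow> forces F V w B \<longleftrightarrow> forces G V' w' B"
proof (induction B arbitrary: w w')
  case (Var p)
  then show ?case using atoms by auto
next
  case (Imp A B)
  have IH: "forces F V u A \<longleftrightarrow> forces G V' u' A" "forces F V u B \<longleftrightarrow> forces G V' u' B"
    if "Z u u'" for u u'
    using Imp that by auto
  show ?case
  proof
    assume L: "forces F V w (Imp A B)"
    show "forces G V' w' (Imp A B)"
      using L IH zag[OF Imp.prems(2)] by (simp, meson)
  next
    assume R: "forces G V' w' (Imp A B)"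
    show "forces F V w (Imp A B)"
      using R IH zig[OF Imp.prems(2)] by (simp, meson)
  qed
qed auto

section \<open>The generality order on unifiers\<close>

definition more_general :: "fm set \<Rightarrow> nat set \<Rightarrow> sbst \<Rightarrow> sbst \<Rightarrow> bool" where
  "more_general L X \<epsilon> \<mu> \<longleftrightarrow> (\<exists>\<alpha>. sbst_eq L X (comp_sbst \<alpha> \<epsilon>) \<mu>)"

lemma more_general_trans:
  assumes F: "is_frame F"
    and "more_general (logic_of F) X \<epsilon> \<tau>" "more_general (logic_of F) X \<tau> \<mu>"
  shows "more_general (logic_of F) X \<epsilon> \<mu>"
proof -
  obtain \<alpha> \<beta> where a: "sbst_eq (logic_of F) X (comp_sbst \<alpha> \<epsilon>) \<tau>"
    and b: "sbst_eq (logic_of F) X (comp_sbst \<beta> \<tau>) \<mu>"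
    using assms unfolding more_general_def by blast
  have "sbst_eq (logic_of F) X (comp_sbst (comp_sbst \<beta> \<alpha>) \<epsilon>) \<mu>"
    unfolding sbst_eq_def Iff_in_logic_of[OF F]
  proof (intro ballI allI impI)
    fix p V w assume p: "p \<in> X" and V: "valuation F V" and w: "w \<in> worlds F"
    have "forces F V w (comp_sbst (comp_sbst \<beta> \<alpha>) \<epsilon> p)
        \<longleftrightarrow> forces F (pull F \<beta> V) w (comp_sbst \<alpha> \<epsilon> p)"
      using w by (simp add: comp_sbst_def[of _ \<epsilon>] subst_comp_sbst forces_subst)
    also have "\<dots> \<longleftrightarrow> forces F (pull F \<beta> V) w (\<tau> p)"
      using a p w valuation_pull[OF F V] unfolding sbst_eq_def Iff_in_logic_of[OF F] by blast
    also have "\<dots> \<longleftrightarrow> forces F V w (comp_sbst \<beta> \<tau> p)"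
      using w by (simp add: comp_sbst_def forces_subst)
    also have "\<dots> \<longleftrightarrow> forces F V w (\<mu> p)"
      using b p w V unfolding sbst_eq_def Iff_in_logic_of[OF F] by blast
    finally show "forces F V w (comp_sbst (comp_sbst \<beta> \<alpha>) \<epsilon> p) \<longleftrightarrow> forces F V w (\<mu> p)" .
  qed
  then show ?thesis unfolding more_general_def by blast
qed

text \<open>Take \<epsilon> in a minimal complete set, a strictly more general \<tau>, and a member
  \<epsilon>' above \<tau>. Then \<epsilon>' differs from \<epsilon> and covers all that \<epsilon>
  covers, so \<epsilon> can be removed.\<close>

lemma nullary_if_no_maximal_unifier:
  assumes F: "is_frame F" and unif: "unifiable (logic_of F) A"
    and step: "\<And>\<epsilon>. unifier (logic_of F) A \<epsilon> \<Longrightarrow> \<exists>\<tau>. unifier (logic_of F) A \<tau> \<and>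
      more_general (logic_of F) (vars A) \<tau> \<epsilon> \<and> \<not> more_general (logic_of F) (vars A) \<epsilon> \<tau>"
  shows "nullary_unification (logic_of F)"
  unfolding nullary_unification_def
proof (intro exI[of _ A] conjI unif notI, elim exE)
  let ?L = "logic_of F"
  let ?ge = "more_general ?L (vars A)"
  fix \<Sigma> assume "minimal_complete_unifiers ?L A \<Sigma>"
  then have \<Sigma>: "\<And>\<epsilon>. \<epsilon> \<in> \<Sigma> \<Longrightarrow> unifier ?L A \<epsilon>"
      "\<And>\<mu>. unifier ?L A \<mu> \<Longrightarrow> \<exists>\<epsilon>\<in>\<Sigma>. ?ge \<epsilon> \<mu>"
    and min: "\<And>\<Sigma>'. \<Sigma>' \<subset> \<Sigma> \<Longrightarrow> \<not> complete_unifiers ?L A \<Sigma>'"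
    unfolding minimal_complete_unifiers_def complete_unifiers_def more_general_def by auto
  obtain \<epsilon> where \<epsilon>: "\<epsilon> \<in> \<Sigma>" using unif \<Sigma>(2) unfolding unifiable_def by blast
  obtain \<tau> where \<tau>: "unifier ?L A \<tau>" "?ge \<tau> \<epsilon>" "\<not> ?ge \<epsilon> \<tau>"
    using step \<Sigma>(1)[OF \<epsilon>] by blast
  obtain \<epsilon>' where \<epsilon>': "\<epsilon>' \<in> \<Sigma>" "?ge \<epsilon>' \<tau>" using \<Sigma>(2)[OF \<tau>(1)] by blast
  have "\<epsilon>' \<noteq> \<epsilon>" using \<epsilon>' \<tau> by blast
  moreover have "?ge \<epsilon>' \<epsilon>" using more_general_trans[OF F \<epsilon>'(2) \<tau>(2)] .
  ultimately have "\<exists>\<delta>\<in>\<Sigma> - {\<epsilon>}. ?ge \<delta> \<mu>" if "unifier ?L A \<mu>" for \<mu>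
    using \<Sigma>(2)[OF that] more_general_trans[OF F] \<epsilon>'(1) by blast
  then have "complete_unifiers ?L A (\<Sigma> - {\<epsilon>})"
    using \<Sigma>(1) unfolding complete_unifiers_def more_general_def by auto
  then show False using min[of "\<Sigma> - {\<epsilon>}"] \<epsilon> by blast
qed

section \<open>The formula and its unifiers\<close>

abbreviation fork_join :: "nat \<Rightarrow> (nat + nat) frame" where
  "fork_join s \<equiv> join (fork 2) (fork s)"

lemma fork_join_simps [simp]:
  "Inl x \<in> worlds (fork_join s) \<longleftrightarrow> x \<le> 2"
  "Inr y \<in> worlds (fork_join s) \<longleftrightarrow> y \<le> s"
  "(Inl x, Inl x') \<in> ord (fork_join s) \<longleftrightarrow> x \<le> 2 \<and> x' \<le> 2 \<and> (x = 0 \<or> x = x')"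
  "(Inr y, Inr y') \<in> ord (fork_join s) \<longleftrightarrow> y \<le> s \<and> y' \<le> s \<and> (y = 0 \<or> y = y')"
  "(Inl x, Inr y) \<in> ord (fork_join s) \<longleftrightarrow> x \<le> 2 \<and> y \<le> s"
  "(Inr y, Inl x) \<notin> ord (fork_join s)"
  by (auto simp: join_def fork_def)

lemma is_frame_fork_join: "is_frame (fork_join s)"
  by (intro is_frame_join is_frame_fork)

lemma ball_fork_join:
  "(\<forall>u\<in>worlds (fork_join s). P u) \<longleftrightarrow>
    P (Inl 0) \<and> P (Inl 1) \<and> P (Inl 2) \<and> (\<forall>y\<le>s. P (Inr y))"
proof -
  have "worlds (fork_join s) = Inl ` {0, 1, 2} \<union> Inr ` {..s}"
    by (auto simp: join_def fork_def)
  then show ?thesis by auto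
qed

section \<open>Negation and final worlds\<close>

definition Neg :: "fm \<Rightarrow> fm" where
  "Neg A = Imp A Bot"

lemma subst_Neg [simp]: "subst \<sigma> (Neg A) = Neg (subst \<sigma> A)"
  by (simp add: Neg_def)

lemma forces_Neg_final:
  "1 \<le> y \<Longrightarrow> y \<le> s \<Longrightarrow> forces (fork_join s) V (Inr y) (Neg A) \<longleftrightarrow> \<not> forces (fork_join s) V (Inr y) A"
  by (auto simp: Neg_def ball_fork_join)

lemma final_above:
  assumes "s \<ge> 1" "w \<in> worlds (fork_join s)"
  shows "\<exists>y\<in>{1..s}. (w, Inr y) \<in> ord (fork_join s)"
proof (cases w)
  case (Inl x)
  then show ?thesis using assms by (intro bexI[of _ 1]) auto
next
  case (Inr y)
  then show ?thesis using assms by (cases "y = 0") (auto intro: bexI[of _ 1] bexI[of _ y])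
qed

text \<open>Every world sees a final one, and truth persists upwards, so final worlds decide
  negations.\<close>

lemma forces_Neg:
  assumes "s \<ge> 1" "valuation (fork_join s) V" "w \<in> worlds (fork_join s)"
  shows "forces (fork_join s) V w (Neg A) \<longleftrightarrow>
    (\<forall>y\<in>{1..s}. (w, Inr y) \<in> ord (fork_join s) \<longrightarrow> \<not> forces (fork_join s) V (Inr y) A)"
proof
  show "\<forall>y\<in>{1..s}. (w, Inr y) \<in> ord (fork_join s) \<longrightarrow> \<not> forces (fork_join s) V (Inr y) A"
    if "forces (fork_join s) V w (Neg A)"
    using that by (simp add: Neg_def)
  assume R: "\<forall>y\<in>{1..s}. (w, Inr y) \<in> ord (fork_join s) \<longrightarrow> \<not> forces (fork_join s) V (Inr y) A"
  have "\<not> forces (fork_join s) V u A" if u: "u \<in> worlds (fork_join s)" "(w, u) \<in> ord (fork_join s)" for u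
    using final_above[OF assms(1) u(1)] R is_frameD(2)[OF is_frame_fork_join u(2)]
      forces_mono[OF is_frame_fork_join assms(2)] by blast
  then show "forces (fork_join s) V w (Neg A)" by (simp add: Neg_def)
qed

text \<open>\<open>Var 0\<close> and \<open>Var 1\<close> are v and w of the overview.\<close>

definition target :: fm where
  "target = And (Or (Var 0) (Var 1)) (And (Neg (Neg (Var 0))) (Neg (Neg (Var 1))))"

lemma vars_target: "vars target = {0, 1}"
  by (auto simp: target_def Neg_def)

text \<open>By persistence the root decides validity; there the double negations say that both
  values hold at all final worlds \<open>Inr y\<close>, y \<ge> 1.\<close>

lemma unifier_target:
  assumes "s \<ge> 1"
  shows "unifier (logic_of (fork_join s)) target \<sigma> \<longleftrightarrow>
    (\<forall>V. valuation (fork_join s) V \<longrightarrow>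
      (forces (fork_join s) V (Inl 0) (\<sigma> 0) \<or> forces (fork_join s) V (Inl 0) (\<sigma> 1)) \<and>
      (\<forall>y\<in>{1..s}. forces (fork_join s) V (Inr y) (\<sigma> 0) \<and> forces (fork_join s) V (Inr y) (\<sigma> 1)))"
proof -
  have "(\<forall>w\<in>worlds (fork_join s). forces (fork_join s) V w (subst \<sigma> target)) \<longleftrightarrow>
    (forces (fork_join s) V (Inl 0) (\<sigma> 0) \<or> forces (fork_join s) V (Inl 0) (\<sigma> 1)) \<and>
      (\<forall>y\<in>{1..s}. forces (fork_join s) V (Inr y) (\<sigma> 0) \<and> forces (fork_join s) V (Inr y) (\<sigma> 1))"
    (is "(\<forall>w\<in>?W. ?f w) \<longleftrightarrow> ?R") if V: "valuation (fork_join s) V" for V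
  proof -
    have mono: "(\<forall>w\<in>?W. ?f w) \<longleftrightarrow> ?f (Inl 0)"
    proof
      assume r: "?f (Inl 0)"
      have "(Inl 0, w) \<in> ord (fork_join s)" if "w \<in> ?W" for w
        using that by (cases w) auto
      then show "\<forall>w\<in>?W. ?f w"
        using forces_mono[OF is_frame_fork_join V _ r] by blast
    qed simp
    show ?thesis
      unfolding mono using forces_Neg_final[of _ s V]
      by (auto simp: target_def forces_Neg[OF assms V])
  qed
  then show ?thesis unfolding unifier_def logic_of_def by auto
qed

section \<open>Gluing two unifiers\<close>

definition glue :: "nat \<Rightarrow> sbst \<Rightarrow> sbst \<Rightarrow> sbst" where
  "glue t \<epsilon> \<sigma> p = And (Imp (Neg (Var t)) (\<epsilon> p)) (Imp (Neg (Neg (Var t))) (\<sigma> p))"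

lemma unifier_glue:
  assumes s: "s \<ge> 1"
    and \<epsilon>: "unifier (logic_of (fork_join s)) target \<epsilon>"
    and \<sigma>: "unifier (logic_of (fork_join s)) target \<sigma>"
  shows "unifier (logic_of (fork_join s)) target (glue t \<epsilon> \<sigma>)"
  unfolding unifier_target[OF s]
proof (intro allI impI)
  fix V assume V: "valuation (fork_join s) V"
  let ?f = "forces (fork_join s) V"
  have final: "?f (Inr y) (glue t \<epsilon> \<sigma> 0) \<and> ?f (Inr y) (glue t \<epsilon> \<sigma> 1)" if "y \<in> {1..s}" for y
    using \<epsilon> \<sigma> V that unfolding unifier_target[OF s] by (auto simp: glue_def ball_fork_join)
  have neg: "?f w (Neg (Var t)) \<longleftrightarrow> (\<forall>y\<in>{1..s}. (w, Inr y) \<in> ord (fork_join s) \<longrightarrow> Inr y \<notin> V t)"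
    and negneg: "?f w (Neg (Neg (Var t))) \<longleftrightarrow>
      (\<forall>y\<in>{1..s}. (w, Inr y) \<in> ord (fork_join s) \<longrightarrow> Inr y \<in> V t)"
    if "w \<in> worlds (fork_join s)" for w
    using forces_Neg_final[of _ s V] that by (auto simp: forces_Neg[OF s V])
  have root: "?f (Inl 0) (glue t \<epsilon> \<sigma> 0) \<or> ?f (Inl 0) (glue t \<epsilon> \<sigma> 1)"
  proof -
    consider (none) "\<forall>y\<in>{1..s}. Inr y \<notin> V t" | (all) "\<forall>y\<in>{1..s}. Inr y \<in> V t"
      | (mixed) "\<exists>y\<in>{1..s}. Inr y \<in> V t" "\<exists>y\<in>{1..s}. Inr y \<notin> V t" by blast
    then show ?thesis
    proof cases
      \<comment> \<open>Here the second conjunct of \<open>glue\<close> is vacuous and the first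
        follows from \<epsilon>; the case \<open>all\<close> is symmetric, with \<sigma>.\<close>
      case none
      then have "\<not> ?f w (Neg (Neg (Var t)))" if "w \<in> worlds (fork_join s)" for w
        using that negneg[OF that] final_above[OF s that] by blast
      then have "?f (Inl 0) (glue t \<epsilon> \<sigma> p)" if "?f (Inl 0) (\<epsilon> p)" for p
        using that forces_mono[OF is_frame_fork_join V] by (auto simp: glue_def)
      then show ?thesis using \<epsilon> V unfolding unifier_target[OF s] by blast
    next
      case all
      then have "\<not> ?f w (Neg (Var t))" if "w \<in> worlds (fork_join s)" for w
        using that neg[OF that] final_above[OF s that] by blast
      then have "?f (Inl 0) (glue t \<epsilon> \<sigma> p)" if "?f (Inl 0) (\<sigma> p)" for p
        using that forces_mono[OF is_frame_fork_join V] by (auto simp: glue_def)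
      then show ?thesis using \<sigma> V unfolding unifier_target[OF s] by blast
    next
      case mixed
      \<comment> \<open>This uses the shape of the frame: all final worlds lie in the upper fork,
        and each nonfinal world lies below all of them. Both premises in \<open>glue\<close>
        therefore fail at nonfinal worlds.\<close>
      have final_or_sees_all: "(\<exists>y\<in>{1..s}. u = Inr y) \<or> (\<forall>y\<in>{1..s}. (u, Inr y) \<in> ord (fork_join s))"
        if "u \<in> worlds (fork_join s)" for u
      proof (cases u)
        case (Inr n)
        then show ?thesis using that by (cases "n = 0") auto
      qed (use that in auto)
      have "?f u (\<epsilon> 0)" if u: "u \<in> worlds (fork_join s)" "?f u (Neg (Var t))" for u
      proof -
        obtain y where "u = Inr y" "y \<in> {1..s}"
          using mixed neg final_or_sees_all[OF u(1)] u by blast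
        then show ?thesis using \<epsilon> V unfolding unifier_target[OF s] by blast
      qed
      moreover have "?f u (\<sigma> 0)" if u: "u \<in> worlds (fork_join s)" "?f u (Neg (Neg (Var t)))" for u
      proof -
        obtain y where "u = Inr y" "y \<in> {1..s}"
          using mixed negneg final_or_sees_all[OF u(1)] u by blast
        then show ?thesis using \<sigma> V unfolding unifier_target[OF s] by blast
      qed
      ultimately show ?thesis by (auto simp: glue_def)
    qed
  qed
  show "(?f (Inl 0) (glue t \<epsilon> \<sigma> 0) \<or> ?f (Inl 0) (glue t \<epsilon> \<sigma> 1)) \<and>
      (\<forall>y\<in>{1..s}. ?f (Inr y) (glue t \<epsilon> \<sigma> 0) \<and> ?f (Inr y) (glue t \<epsilon> \<sigma> 1))"
    using root final by blast
qed

text \<open>Replacing t by \<open>Bot\<close> makes the first premise true and the second false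
  everywhere, which leaves \<epsilon>; \<open>Neg Bot\<close> leaves \<sigma> instead. Freshness
  keeps \<epsilon> and \<sigma> themselves unchanged.\<close>

lemma glue_more_general:
  assumes s: "s \<ge> 1" and t: "\<And>p. p \<in> X \<Longrightarrow> t \<notin> vars (\<epsilon> p) \<union> vars (\<sigma> p)"
  shows "more_general (logic_of (fork_join s)) X (glue t \<epsilon> \<sigma>) \<epsilon>"
    and "more_general (logic_of (fork_join s)) X (glue t \<epsilon> \<sigma>) \<sigma>"
proof -
  let ?f = "forces (fork_join s)"
  have self: "(\<forall>u\<in>worlds (fork_join s). (w, u) \<in> ord (fork_join s) \<longrightarrow> ?f V u A) \<longleftrightarrow> ?f V w A"
    if "valuation (fork_join s) V" "w \<in> worlds (fork_join s)" for V w A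
    using that(2) is_frameD(1)[OF is_frame_fork_join that(2)]
      forces_mono[OF is_frame_fork_join that(1), of w _ A] by blast
  have contra: "\<not> ?f V w (Neg A)" if "w \<in> worlds (fork_join s)" "?f V w A" for V w A
    using that is_frameD(1)[OF is_frame_fork_join that(1)] unfolding Neg_def forces.simps by blast
  have nB: "?f V w (Neg Bot)" for V w by (simp add: Neg_def)
  then have nnB: "w \<in> worlds (fork_join s) \<Longrightarrow> \<not> ?f V w (Neg (Neg Bot))" for V w
    by (intro contra)
  have nnnB: "?f V w (Neg (Neg (Neg Bot)))" for V w
    using nnB by (simp add: Neg_def[of "Neg (Neg Bot)"])
  have "sbst_eq (logic_of (fork_join s)) X (comp_sbst (Var(t := Bot)) (glue t \<epsilon> \<sigma>)) \<epsilon>"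
    unfolding sbst_eq_def Iff_in_logic_of[OF is_frame_fork_join]
    using t by (simp add: comp_sbst_def glue_def subst_fresh nB nnB self)
  then show "more_general (logic_of (fork_join s)) X (glue t \<epsilon> \<sigma>) \<epsilon>"
    unfolding more_general_def by blast
  have "sbst_eq (logic_of (fork_join s)) X (comp_sbst (Var(t := Neg Bot)) (glue t \<epsilon> \<sigma>)) \<sigma>"
    unfolding sbst_eq_def Iff_in_logic_of[OF is_frame_fork_join]
    using t by (simp add: comp_sbst_def glue_def subst_fresh nnB nnnB self)
  then show "more_general (logic_of (fork_join s)) X (glue t \<epsilon> \<sigma>) \<sigma>"
    unfolding more_general_def by blast
qed

section \<open>Unifiers with arbitrarily many variables\<close>

definition Conj :: "fm list \<Rightarrow> fm" where
  "Conj As = foldr And As (Neg Bot)"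

definition Disj :: "fm list \<Rightarrow> fm" where
  "Disj As = foldr Or As Bot"

lemma forces_Conj [simp]: "forces F V w (Conj As) \<longleftrightarrow> (\<forall>A\<in>set As. forces F V w A)"
  by (induction As) (auto simp: Conj_def Neg_def)

lemma forces_Disj [simp]: "forces F V w (Disj As) \<longleftrightarrow> (\<exists>A\<in>set As. forces F V w A)"
  by (induction As) (auto simp: Disj_def)

definition all_nn :: "nat \<Rightarrow> fm" where
  "all_nn m = Neg (Neg (Conj (map Var [0..<m])))"

definition lin :: "nat \<Rightarrow> fm" where
  "lin m = Conj [Or (Imp (Var i) (Var j)) (Imp (Var j) (Var i)). i \<leftarrow> [0..<m], j \<leftarrow> [0..<m]]"

text \<open>The variable \<open>z\<^sub>i\<close> of the overview is \<open>Var i\<close>, so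
  \<open>Var 0\<close> is v as an argument but \<open>z\<^sub>0\<close> inside the values.\<close>

definition lin_sbst :: "nat \<Rightarrow> sbst" where
  "lin_sbst m p =
    (if p = 0 then Imp (all_nn m) (lin m)
     else Imp (And (all_nn m) (lin m)) (Disj (map Var [0..<m])))"

lemma forces_all_nn:
  assumes "s \<ge> 1" "valuation (fork_join s) V" "w \<in> worlds (fork_join s)"
  shows "forces (fork_join s) V w (all_nn m) \<longleftrightarrow>
    (\<forall>y\<in>{1..s}. (w, Inr y) \<in> ord (fork_join s) \<longrightarrow> (\<forall>i<m. Inr y \<in> V i))"
  using assms(3) forces_Neg_final[of _ s V] unfolding all_nn_def
  by (auto simp: forces_Neg[OF assms(1,2)])

lemma forces_lin:
  "forces F V w (lin m) \<longleftrightarrow> (\<forall>i<m. \<forall>j<m. forces F V w (Imp (Var i) (Var j)) \<or> forces F V w (Imp (Var j) (Var i)))"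
  by (simp add: lin_def del: forces.simps(5)) fastforce

text \<open>If both values failed at the root, a failure of \<open>lin\<close> below true final
  worlds would need two incomparable nonfinal worlds, which can only be \<open>Inl 1\<close> and
  \<open>Inl 2\<close>. The world refuting the second value forces no \<open>z\<^sub>i\<close>, so
  it is the root; but the root sees both worlds and cannot force \<open>lin\<close>.\<close>

lemma unifier_lin_sbst:
  assumes s: "s \<ge> 1" and m: "m \<ge> 1"
  shows "unifier (logic_of (fork_join s)) target (lin_sbst m)"
  unfolding unifier_target[OF s]
proof (intro allI impI conjI ballI)
  fix V assume V: "valuation (fork_join s) V"
  let ?f = "forces (fork_join s) V"
  show "?f (Inr y) (lin_sbst m 0)" "?f (Inr y) (lin_sbst m 1)" if "y \<in> {1..s}" for y
  proof -
    have "?f (Inr y) (all_nn m) \<longleftrightarrow> (\<forall>i<m. Inr y \<in> V i)"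
      using that by (auto simp: forces_all_nn[OF s V])
    \<comment> \<open>With m = 0 the disjunction would be \<open>Bot\<close> and the second value
      would fail at final worlds.\<close>
    moreover have ex_lt: "\<exists>x. x < m" using m by (intro exI[of _ 0]) simp
    ultimately show "?f (Inr y) (lin_sbst m 0)" "?f (Inr y) (lin_sbst m 1)"
      using ex_lt that by (auto simp: lin_sbst_def forces_lin ball_fork_join)
  qed
  show "?f (Inl 0) (lin_sbst m 0) \<or> ?f (Inl 0) (lin_sbst m 1)"
  proof (rule ccontr)
    assume neither: "\<not> ?thesis"
    then obtain u where u: "u \<in> worlds (fork_join s)" "?f u (lin m)"
      and no_z: "\<And>i. i < m \<Longrightarrow> u \<notin> V i"
      by (auto simp: lin_sbst_def)
    obtain u' where u': "u' \<in> worlds (fork_join s)" "?f u' (all_nn m)" "\<not> ?f u' (lin m)"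
      using neither by (auto simp: lin_sbst_def)
    then obtain i j y y' where ij: "i < m" "j < m"
      and y: "y \<in> worlds (fork_join s)" "(u', y) \<in> ord (fork_join s)" "y \<in> V i" "y \<notin> V j"
      and y': "y' \<in> worlds (fork_join s)" "(u', y') \<in> ord (fork_join s)" "y' \<in> V j" "y' \<notin> V i"
      unfolding forces_lin forces.simps by blast
    have up: "x' \<in> V p" if "(x, x') \<in> ord (fork_join s)" "x \<in> V p" for x x' p
      using that V unfolding valuation_def by blast
    have incomp: "(y, y') \<notin> ord (fork_join s)" "(y', y) \<notin> ord (fork_join s)"
      using up[of y y' i] up[of y' y j] y y' by blast+
    have not_final: "y \<noteq> Inr n \<and> y' \<noteq> Inr n" if "n \<in> {1..s}" for n
      using u'(2) ij(1,2) y(2,4) y'(2,4) that unfolding forces_all_nn[OF s V u'(1)] by blast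
    have y_mid: "\<exists>k\<in>{1, 2}. y = Inl k"
    proof (cases y)
      case (Inl k)
      then have "k \<noteq> 0" using y'(1) incomp(1) by (cases y') auto
      then show ?thesis using Inl y(1) by auto
    next
      \<comment> \<open>The only nonfinal world of the upper fork is \<open>Inr 0\<close>, which is
        comparable with every world.\<close>
      case (Inr n)
      then have "n = 0" using y(1) not_final[of n] by (cases n) auto
      then show ?thesis using y(1) y'(1) incomp Inr by (cases y') auto
    qed
    have y'_mid: "\<exists>k\<in>{1, 2}. y' = Inl k"
    proof (cases y')
      case (Inl k)
      then have "k \<noteq> 0" using y(1) incomp(2) by (cases y) auto
      then show ?thesis using Inl y'(1) by auto
    next
      case (Inr n)
      then have "n = 0" using y'(1) not_final[of n] by (cases n) auto
      then show ?thesis using y(1) y'(1) incomp Inr by (cases y) auto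
    qed
    have "y \<noteq> y'" using y(3) y'(4) by blast
    then have yy: "{y, y'} = {Inl 1, Inl 2}" using y_mid y'_mid by auto
    have "u \<noteq> y" "u \<noteq> y'" using no_z y(3) y'(3) ij(1,2) by blast+
    then have not_mid: "u \<noteq> Inl 1" "u \<noteq> Inl 2" using yy by blast+
    have "(y, u) \<notin> ord (fork_join s)"
      using up[of y u i] no_z[OF ij(1)] y(3) by blast
    then have "u \<noteq> Inr n" for n
      using u(1) y(1) y_mid by auto
    then obtain k where k: "u = Inl k" by (cases u) auto
    then have "k = 0" using u(1) not_mid by (cases "k = 1 \<or> k = 2") auto
    then have "(u, y) \<in> ord (fork_join s)" "(u, y') \<in> ord (fork_join s)"
      using k y_mid y'_mid by auto
    then have "\<not> ?f u (Imp (Var i) (Var j))" "\<not> ?f u (Imp (Var j) (Var i))"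
      using y(1,3,4) y'(1,3,4) unfolding forces.simps by blast+
    then show False
      using u(2) ij(1,2) unfolding forces_lin by blast
  qed
qed

section \<open>No unifier is maximal\<close>

text \<open>The chain \<open>C\<^sub>i\<close> with bottom \<open>Inr 0\<close> and all final worlds
  as its top; the lower fork forces no variable.\<close>

definition chain_val :: "nat \<Rightarrow> nat \<Rightarrow> nat \<Rightarrow> (nat + nat) set" where
  "chain_val s i p = {u. \<exists>n\<le>s. u = Inr n \<and> (n \<noteq> 0 \<or> p \<noteq> i)}"

text \<open>\<open>C\<^sub>i\<close> and \<open>C\<^sub>j\<close> with bottoms \<open>Inl 1\<close>
  and \<open>Inl 2\<close>, glued at the top: the whole upper fork, \<open>Inr 0\<close> included,
  acts as one top world.\<close>

definition fork_val :: "nat \<Rightarrow> nat \<Rightarrow> nat \<Rightarrow> nat \<Rightarrow> (nat + nat) set" where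
  "fork_val s i j p = Inr ` {..s} \<union> {u. u = Inl 1 \<and> p \<noteq> i} \<union> {u. u = Inl 2 \<and> p \<noteq> j}"

lemma valuation_chain_val: "valuation (fork_join s) (chain_val s i)"
proof -
  have "u \<in> chain_val s i p" if "w \<in> chain_val s i p" "(w, u) \<in> ord (fork_join s)" for w u p
    using that by (cases u) (auto simp: chain_val_def)
  moreover have "chain_val s i p \<subseteq> worlds (fork_join s)" for p
    by (auto simp: chain_val_def)
  ultimately show ?thesis unfolding valuation_def by blast
qed

lemma valuation_fork_val: "valuation (fork_join s) (fork_val s i j)"
proof -
  have "u \<in> fork_val s i j p" if "w \<in> fork_val s i j p" "(w, u) \<in> ord (fork_join s)" for w u p
    using that by (cases u) (auto simp: fork_val_def)
  moreover have "fork_val s i j p \<subseteq> worlds (fork_join s)" for p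
    by (auto simp: fork_val_def)
  ultimately show ?thesis unfolding valuation_def by blast
qed

text \<open>Above \<open>Inl 1\<close> the variables have only two truth sets, one inside the other,
  so \<open>lin\<close> holds although no variable is forced.\<close>

lemma chain_val_refutes:
  assumes s: "s \<ge> 1" and m: "m \<ge> 2"
  shows "\<not> forces (fork_join s) (chain_val s i) (Inl 1) (lin_sbst m 1)"
proof -
  let ?f = "forces (fork_join s) (chain_val s i)"
  have "?f (Inl 1) (all_nn m)"
    using forces_all_nn[OF s valuation_chain_val] by (auto simp: chain_val_def)
  moreover have "?f (Inl 1) (lin m)"
    unfolding forces_lin by (auto simp: ball_fork_join chain_val_def)
  moreover have "\<not> ?f (Inl 1) (Disj (map Var [0..<m]))"
    by (auto simp: chain_val_def)
  ultimately show ?thesis by (auto simp: lin_sbst_def ball_fork_join)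
qed

text \<open>\<open>Inl 1\<close> refutes \<open>z\<^sub>j\<close> \<longrightarrow>
  \<open>z\<^sub>i\<close>, and \<open>Inl 2\<close> refutes the converse.\<close>

lemma fork_val_refutes:
  assumes s: "s \<ge> 1" and ij: "i < m" "j < m" "i \<noteq> j"
  shows "\<not> forces (fork_join s) (fork_val s i j) (Inl 0) (lin_sbst m 0)"
proof -
  let ?f = "forces (fork_join s) (fork_val s i j)"
  have "?f (Inl 0) (all_nn m)"
    using forces_all_nn[OF s valuation_fork_val] by (auto simp: fork_val_def)
  moreover have "\<not> ?f (Inl 0) (lin m)"
    unfolding forces_lin using ij by (auto simp: ball_fork_join fork_val_def)
  ultimately show ?thesis by (auto simp: lin_sbst_def ball_fork_join)
qed

text \<open>Both worlds are bottoms of the same chain up to bisimulation, so they agree on all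
  formulas, in particular on the values of any \<alpha>.\<close>

lemma chain_val_fork_val:
  assumes s: "s \<ge> 1" and k: "k = 1 \<and> l = i \<or> k = 2 \<and> l = j"
  shows "forces (fork_join s) (chain_val s l) (Inr 0) B \<longleftrightarrow> forces (fork_join s) (fork_val s i j) (Inl k) B"
proof -
  define Z where "Z w w' \<longleftrightarrow> w = Inr 0 \<and> w' = Inl k \<or> (\<exists>n\<in>{1..s}. \<exists>n'\<le>s. w = Inr n \<and> w' = Inr n')"
    for w w' :: "nat + nat"
  show ?thesis
  proof (rule forces_bisimilar[where Z = Z and K = UNIV])
    show "w \<in> chain_val s l p \<longleftrightarrow> w' \<in> fork_val s i j p" if "Z w w'" for w w' p
      using that k unfolding Z_def by (auto simp: chain_val_def fork_val_def)
    show "\<exists>u'\<in>worlds (fork_join s). (w', u') \<in> ord (fork_join s) \<and> Z u u'"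
      if "Z w w'" "u \<in> worlds (fork_join s)" "(w, u) \<in> ord (fork_join s)" for w w' u
    proof (cases "u = Inr 0")
      case True
      then show ?thesis
        using that k unfolding Z_def by (intro bexI[of _ "Inl k"]) auto
    next
      case False
      then have u: "\<exists>n\<in>{1..s}. u = Inr n"
        using that unfolding Z_def by (cases u) auto
      show ?thesis
      proof (cases w')
        case (Inl x)
        then show ?thesis using u that k unfolding Z_def by (intro bexI[of _ "Inr 0"]) auto
      next
        case (Inr n')
        then show ?thesis using u that k unfolding Z_def by (intro bexI[of _ w']) auto
      qed
    qed
    show "\<exists>u\<in>worlds (fork_join s). (w, u) \<in> ord (fork_join s) \<and> Z u u'"
      if "Z w w'" "u' \<in> worlds (fork_join s)" "(w', u') \<in> ord (fork_join s)" for w w' u'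
    proof (cases u')
      case (Inl x)
      then show ?thesis using that k unfolding Z_def by (intro bexI[of _ "Inr 0"]) auto
    next
      case (Inr n')
      then show ?thesis
      proof (cases "w = Inr 0")
        case True
        then show ?thesis using that Inr s unfolding Z_def by (intro bexI[of _ "Inr 1"]) auto
      next
        case False
        then show ?thesis using that Inr unfolding Z_def by (intro bexI[of _ w]) auto
      qed
    qed
    show "Z (Inr 0) (Inl k)" by (simp add: Z_def)
  qed simp
qed

lemma chain_val_fork_val_final:
  assumes "n \<in> {1..s}" "n' \<le> s"
  shows "forces (fork_join s) (chain_val s l) (Inr n) B \<longleftrightarrow> forces (fork_join s) (fork_val s i j) (Inr n') B"
proof (rule forces_bisimilar[where Z = "\<lambda>w w'. w = Inr n \<and> (\<exists>n'\<le>s. w' = Inr n')" and K = UNIV])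
  show "\<exists>u'\<in>worlds (fork_join s). (w', u') \<in> ord (fork_join s) \<and> u = Inr n \<and> (\<exists>n'\<le>s. u' = Inr n')"
    if "w = Inr n \<and> (\<exists>n'\<le>s. w' = Inr n')" "u \<in> worlds (fork_join s)" "(w, u) \<in> ord (fork_join s)"
    for w w' u
    using that assms by (cases u) (auto intro: bexI[of _ w'])
  show "\<exists>u\<in>worlds (fork_join s). (w, u) \<in> ord (fork_join s) \<and> u = Inr n \<and> (\<exists>n'\<le>s. u' = Inr n')"
    if "w = Inr n \<and> (\<exists>n'\<le>s. w' = Inr n')" "u' \<in> worlds (fork_join s)" "(w', u') \<in> ord (fork_join s)"
    for w w' u'
    using that assms by (cases u') (auto intro: bexI[of _ w])
qed (use assms in \<open>auto simp: chain_val_def fork_val_def\<close>)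

lemma not_more_general_lin_sbst:
  assumes s: "s \<ge> 1" and \<epsilon>: "unifier (logic_of (fork_join s)) target \<epsilon>"
    and m: "2 ^ card (vars (\<epsilon> 0) \<union> vars (\<epsilon> 1)) < m"
  shows "\<not> more_general (logic_of (fork_join s)) (vars target) \<epsilon> (lin_sbst m)"
proof
  let ?F = "fork_join s"
  define K where "K = vars (\<epsilon> 0) \<union> vars (\<epsilon> 1)"
  have finK: "finite K" unfolding K_def by (simp add: finite_vars)
  have "(1::nat) \<le> 2 ^ card K" by simp
  then have m2: "m \<ge> 2" using m unfolding K_def by linarith
  assume "more_general (logic_of ?F) (vars target) \<epsilon> (lin_sbst m)"
  then obtain \<alpha> where "sbst_eq (logic_of ?F) {0, 1} (comp_sbst \<alpha> \<epsilon>) (lin_sbst m)"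
    unfolding more_general_def vars_target by blast
  then have eq: "forces ?F (pull ?F \<alpha> V) w (\<epsilon> p) \<longleftrightarrow> forces ?F V w (lin_sbst m p)"
    if "valuation ?F V" "w \<in> worlds ?F" "p \<in> {0, 1}" for V w p
    using that forces_subst[OF that(2)]
    unfolding sbst_eq_def Iff_in_logic_of[OF is_frame_fork_join] comp_sbst_def by metis
  \<comment> \<open>The models that \<alpha> induces for the variables of \<epsilon>; by
    \<open>eq\<close>, \<epsilon> behaves in them as \<open>lin_sbst m\<close> does in the original
    ones.\<close>
  define X where "X i = pull ?F \<alpha> (chain_val s i)" for i
  define R where "R i j = pull ?F \<alpha> (fork_val s i j)" for i j
  \<comment> \<open>There are more chains than subsets of \<open>K\<close>, so two chain bottoms
    force the same variables of \<open>K\<close>.\<close>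
  have "\<not> inj_on (\<lambda>i. {p \<in> K. Inr 0 \<in> X i p}) {..<m}"
  proof (rule pigeonhole)
    have "card ((\<lambda>i. {p \<in> K. Inr 0 \<in> X i p}) ` {..<m}) \<le> card (Pow K)"
      by (rule card_mono) (use finK in auto)
    then show "card ((\<lambda>i. {p \<in> K. Inr 0 \<in> X i p}) ` {..<m}) < card {..<m}"
      using m finK by (simp add: card_Pow K_def)
  qed
  then obtain i j where ij: "i < m" "j < m" "i \<noteq> j"
    and "{p \<in> K. Inr 0 \<in> X i p} = {p \<in> K. Inr 0 \<in> X j p}"
    unfolding inj_on_def by auto
  then have same: "Inr 0 \<in> X i p \<longleftrightarrow> Inr 0 \<in> X j p" if "p \<in> K" for p using that by blast
  have XR: "Inr 0 \<in> X i p \<longleftrightarrow> Inl 1 \<in> R i j p" "Inr 0 \<in> X j p \<longleftrightarrow> Inl 2 \<in> R i j p"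
    "n \<in> {1..s} \<Longrightarrow> n' \<le> s \<Longrightarrow> Inr n \<in> X i p \<longleftrightarrow> Inr n' \<in> R i j p" for p n n'
    using chain_val_fork_val[OF s, of 1 i i j "\<alpha> p"] chain_val_fork_val[OF s, of 2 j i j "\<alpha> p"]
      chain_val_fork_val_final[of n s n' i "\<alpha> p" i j]
    unfolding X_def R_def pull_def by auto
  have valX: "valuation ?F (X i)" and valR: "valuation ?F (R i j)"
    unfolding X_def R_def
    by (intro valuation_pull is_frame_fork_join valuation_chain_val valuation_fork_val)+
  \<comment> \<open>The merged model: \<open>X i\<close> on \<open>Inl 1\<close> and the upper fork,
    a copy of the root of \<open>R i j\<close> at \<open>Inl 2\<close>, and no variable at the
    root.\<close>
  define M where "M p = {u \<in> X i p. u \<noteq> Inl 0 \<and> u \<noteq> Inl 2} \<union> {u. u = Inl 2 \<and> Inl 0 \<in> R i j p}" for p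
  have "Inr 0 \<in> X i p" if "Inl 0 \<in> R i j p" for p
    unfolding XR(1) using valR that unfolding valuation_def by (metis fork_join_simps(3) one_le_numeral zero_le)
  \<comment> \<open>This makes \<open>M\<close> persistent at \<open>Inl 2\<close>.\<close>
  then have RX: "Inr n \<in> X i p" if "Inl 0 \<in> R i j p" "n \<le> s" for p n
    using valX that unfolding valuation_def by (metis fork_join_simps(4) zero_le)
  have valM: "valuation ?F M"
  proof -
    have "u \<in> M p" if w: "w \<in> M p" "(w, u) \<in> ord ?F" for w u p
    proof (cases "w = Inl 2")
      case True
      then show ?thesis using w RX by (cases u) (auto simp: M_def)
    next
      case False
      then have "u \<in> X i p" using w valX unfolding M_def valuation_def by blast
      moreover have "u \<noteq> Inl 0" "u \<noteq> Inl 2"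
        using w False unfolding M_def by (cases w; auto)+
      ultimately show ?thesis unfolding M_def by blast
    qed
    moreover have "M p \<subseteq> worlds ?F" for p
      using valX unfolding M_def valuation_def by auto
    ultimately show ?thesis unfolding valuation_def by blast
  qed
  have M1: "forces ?F M (Inl 1) B \<longleftrightarrow> forces ?F (X i) (Inl 1) B" for B
  proof (rule forces_bisimilar[where Z = "\<lambda>w w'. w = w' \<and> (Inl 1, w) \<in> ord ?F" and K = UNIV])
    show "w \<in> M p \<longleftrightarrow> w' \<in> X i p" if "w = w' \<and> (Inl 1, w) \<in> ord ?F" for w w' p
      using that unfolding M_def by auto
    show "\<exists>u'\<in>worlds ?F. (w', u') \<in> ord ?F \<and> u = u' \<and> (Inl 1, u) \<in> ord ?F"
      if "w = w' \<and> (Inl 1, w) \<in> ord ?F" "u \<in> worlds ?F" "(w, u) \<in> ord ?F" for w w' u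
      using that is_frameD(2)[OF is_frame_fork_join] by blast
    show "\<exists>u\<in>worlds ?F. (w, u) \<in> ord ?F \<and> u = u' \<and> (Inl 1, u) \<in> ord ?F"
      if "w = w' \<and> (Inl 1, w) \<in> ord ?F" "u' \<in> worlds ?F" "(w', u') \<in> ord ?F" for w w' u'
      using that is_frameD(2)[OF is_frame_fork_join] by blast
  qed simp_all
  \<comment> \<open>\<open>Inr 0\<close> is matched with both chain bottoms of \<open>R i j\<close>.
    For \<open>Inl 2\<close> this rests on \<open>same\<close>, hence the restriction to
    \<open>K\<close>.\<close>
  have M2: "forces ?F M (Inl 2) B \<longleftrightarrow> forces ?F (R i j) (Inl 0) B" if "vars B \<subseteq> K" for B
  proof -
    define Z where "Z w w' \<longleftrightarrow> w = Inl 2 \<and> w' = Inl 0 \<or> w = Inr 0 \<and> (w' = Inl 1 \<or> w' = Inl 2)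
      \<or> (\<exists>n\<in>{1..s}. \<exists>n'\<le>s. w = Inr n \<and> w' = Inr n')" for w w' :: "nat + nat"
    show ?thesis
    proof (rule forces_bisimilar[where Z = Z and K = K])
      show "w \<in> M p \<longleftrightarrow> w' \<in> R i j p" if "Z w w'" "p \<in> K" for w w' p
        using that XR same unfolding Z_def M_def by auto
      show "\<exists>u'\<in>worlds ?F. (w', u') \<in> ord ?F \<and> Z u u'"
        if "Z w w'" "u \<in> worlds ?F" "(w, u) \<in> ord ?F" for w w' u
      proof -
        have "u = w \<or> w = Inl 2 \<and> u = Inr 0 \<or> (\<exists>n\<in>{1..s}. u = Inr n \<and> (\<exists>x. w' = Inl x))"
          using that unfolding Z_def by (cases u) auto
        then consider "u = w" | "w = Inl 2" "u = Inr 0"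
          | n where "u = Inr n" "n \<in> {1..s}" "\<exists>x. w' = Inl x" by blast
        then show ?thesis
        proof cases
          case 1
          then show ?thesis
            using that by (intro bexI[of _ w']) (auto simp: Z_def)
        next
          case 2
          then show ?thesis
            using that by (intro bexI[of _ "Inl 1"]) (auto simp: Z_def)
        next
          case 3
          then show ?thesis
            using that by (intro bexI[of _ "Inr 0"]) (auto simp: Z_def)
        qed
      qed
      show "\<exists>u\<in>worlds ?F. (w, u) \<in> ord ?F \<and> Z u u'"
        if "Z w w'" "u' \<in> worlds ?F" "(w', u') \<in> ord ?F" for w w' u'
      proof -
        have "u' = w' \<or> w = Inl 2 \<and> (u' = Inl 1 \<or> u' = Inl 2)
          \<or> (\<exists>n'\<le>s. u' = Inr n' \<and> ((\<exists>n\<in>{1..s}. w = Inr n) \<or> w = Inl 2 \<or> w = Inr 0))"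
        proof (cases u')
          case (Inl x)
          have "x = 0 \<or> x = 1 \<or> x = 2" using that(2) Inl by auto
          then show ?thesis using that Inl unfolding Z_def by auto
        next
          case (Inr n')
          then show ?thesis using that unfolding Z_def by auto
        qed
        then consider "u' = w'" | "w = Inl 2" "u' = Inl 1 \<or> u' = Inl 2"
          | n' n where "u' = Inr n'" "n' \<le> s" "w = Inr n" "n \<in> {1..s}"
          | n' where "u' = Inr n'" "n' \<le> s" "w = Inl 2 \<or> w = Inr 0" by blast
        then show ?thesis
        proof cases
          case 1
          then show ?thesis
            using that s by (intro bexI[of _ w]) (auto simp: Z_def)
        next
          case 2
          then show ?thesis
            using that by (intro bexI[of _ "Inr 0"]) (auto simp: Z_def)
        next
          case 3
          then show ?thesis
            using that by (intro bexI[of _ w]) (auto simp: Z_def)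
        next
          case 4
          then show ?thesis
            using that s by (intro bexI[of _ "Inr 1"]) (auto simp: Z_def)
        qed
      qed
      show "Z (Inl 2) (Inl 0)" by (simp add: Z_def)
    qed (use that in simp)
  qed
  have "\<not> forces ?F M (Inl 1) (\<epsilon> 1)"
    using M1 eq[OF valuation_chain_val, of "Inl 1" 1 i] chain_val_refutes[OF s m2]
    unfolding X_def by simp
  moreover have "\<not> forces ?F M (Inl 2) (\<epsilon> 0)"
    using M2[of "\<epsilon> 0"] eq[OF valuation_fork_val, of "Inl 0" 0 i j] fork_val_refutes[OF s ij]
    unfolding R_def K_def by simp
  \<comment> \<open>Whichever value holds at the root persists to both middle worlds, but
    \<open>Inl 2\<close> refutes the first and \<open>Inl 1\<close> the second.\<close>
  moreover have "forces ?F M (Inl 0) (\<epsilon> 0) \<or> forces ?F M (Inl 0) (\<epsilon> 1)"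
    using \<epsilon> valM unfolding unifier_target[OF s] by blast
  ultimately show False
    using forces_mono[OF is_frame_fork_join valM, of "Inl 0"] by (metis fork_join_simps(3) one_le_numeral order_refl zero_le)
qed

theorem theorem5p7:
  fixes s :: nat
  assumes "s \<ge> 1"
  shows "nullary_unification (logic_of (join (fork 2) (fork s)))"
proof (rule nullary_if_no_maximal_unifier[OF is_frame_fork_join, of _ target])
  let ?L = "logic_of (fork_join s)"
  show "unifiable ?L target"
    using unifier_lin_sbst[OF assms, of 1] unfolding unifiable_def by blast
  fix \<epsilon> assume \<epsilon>: "unifier ?L target \<epsilon>"
  \<comment> \<open>One more than the number of sets of variables of \<epsilon>, as the pigeonhole
    argument requires.\<close>
  define m :: nat where "m = Suc (2 ^ card (vars (\<epsilon> 0) \<union> vars (\<epsilon> 1)))"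
  let ?Y = "\<Union>p\<in>vars target. vars (\<epsilon> p) \<union> vars (lin_sbst m p)"
  have "finite ?Y" by (simp add: finite_vars)
  then obtain t where t: "t \<notin> ?Y" using ex_new_if_finite[OF infinite_UNIV_nat] by blast
  let ?\<tau> = "glue t \<epsilon> (lin_sbst m)"
  have "unifier ?L target (lin_sbst m)"
    using unifier_lin_sbst[OF assms] by (simp add: m_def)
  then have "unifier ?L target ?\<tau>" using unifier_glue[OF assms \<epsilon>] by blast
  moreover have ge: "more_general ?L (vars target) ?\<tau> \<epsilon>" "more_general ?L (vars target) ?\<tau> (lin_sbst m)"
    using t by (auto intro!: glue_more_general[OF assms])
  \<comment> \<open>Otherwise \<epsilon> would also be more general than \<open>lin_sbst m\<close>,
    by transitivity.\<close>
  moreover have "\<not> more_general ?L (vars target) \<epsilon> ?\<tau>"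
    using more_general_trans[OF is_frame_fork_join _ ge(2)]
      not_more_general_lin_sbst[OF assms \<epsilon>, of m] by (auto simp: m_def)
  ultimately show "\<exists>\<tau>. unifier ?L target \<tau> \<and> more_general ?L (vars target) \<tau> \<epsilon> \<and>
      \<not> more_general ?L (vars target) \<epsilon> \<tau>" by blast
qed

end
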